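(* Let $f\in H^2(\mathbb{D}^2)$ with $f(0,0)\neq 0$, let $n\ge 0$ be an integer, and let $p_n^*[f]$ be the $n$-th optimal polynomial approximant to $1/f$ in $H^2(\mathbb{D}^2)$. If there are $\alpha\in\mathbb{C}$ and a two-variable polynomial $\tilde p$ such that $p_n^*[f](z,w)=(z-\alpha)\,\tilde p(z,w)$, then $|\alpha|>1$. Similarly, if there are $\beta\in\mathbb{C}$ and a two-variable polynomial $\tilde q$ such that $p_n^*[f](z,w)=(w-\beta)\,\tilde q(z,w)$, then $|\beta|>1$.
   Context: $\mathbb{D}$ is the open unit disk in $\mathbb{C}$ and $H^2(\mathbb{D}^2)$ is the Hardy space on the bidisk: holomorphic functions on $\mathbb{D}^2$ with square-summable Taylor coefficients, with inner product $\langle f,g\rangle=\sum_{i,j\ge0}a_{i,j}\overline{b_{i,j}}$ for $f=\sum a_{i,j}z^iw^j$, $g=\sum b_{i,j}z^iw^j$ (equivalently, the $L^2(\mathbb{T}^2)$ inner product of boundary values with respect to normalized Lebesgue measure). The monomials in $z,w$ are enumerated in degree lexicographic order (increasing total degree; within total degree $d$ the order is $z^d, z^{d-1}w,\dots,w^d$): $\chi_0=1,\ \chi_1=z,\ \chi_2=w,\ \chi_3=z^2,\ \chi_4=zw,\ \chi_5=w^2,\dots$. Put $\mathcal{P}_n=\operatorname{span}\{\chi_0,\dots,\chi_n\}$. For $f\in H^2(\mathbb{D}^2)$ not identically zero and $n\ge0$, the $n$-th optimal polynomial approximant (OPA) to $1/f$, denoted $p_n^*[f]$, is the unique $p\in\mathcal{P}_n$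 minimizing $\|pf-1\|$ over $\mathcal{P}_n$; equivalently, $p_n^*[f]f$ is the orthogonal projection of $1$ onto $\mathcal{P}_nf=\{pf:p\in\mathcal{P}_n\}$. *)

theory Defs
  imports
    "HOL-Analysis.Analysis"
    "HOL-Computational_Algebra.Polynomial"
    "HOL-Library.Nat_Bijection"
begin

definition bidisk :: "(complex \<times> complex) set" where
  "bidisk = ball 0 1 \<times> ball 0 1"

definition holomorphic_bidisk :: "(complex \<times> complex \<Rightarrow> complex) \<Rightarrow> bool" where
  "holomorphic_bidisk f \<longleftrightarrow>
     (\<forall>x\<in>bidisk. \<exists>a b. (f has_derivative (\<lambda>(h, k). a * h + b * k)) (at x))"

text \<open>The Taylor coefficient at the origin belonging to the monomial
  \<open>z ^ i * w ^ j\<close>. It depends only on the values of the function on the bidisk.\<close>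

definition taylor_coeff :: "(complex \<times> complex \<Rightarrow> complex) \<Rightarrow> nat \<Rightarrow> nat \<Rightarrow> complex" where
  "taylor_coeff f i j =
     (deriv ^^ i) (\<lambda>z. (deriv ^^ j) (\<lambda>w. f (z, w)) 0) 0 / (fact i * fact j)"

definition hardy2 :: "(complex \<times> complex \<Rightarrow> complex) set" where
  "hardy2 = {f. holomorphic_bidisk f \<and>
                (\<lambda>(i, j). (cmod (taylor_coeff f i j))\<^sup>2) summable_on UNIV}"

definition hardy2_norm :: "(complex \<times> complex \<Rightarrow> complex) \<Rightarrow> real" where
  "hardy2_norm f = sqrt (\<Sum>\<^sub>\<infinity>(i, j). (cmod (taylor_coeff f i j))\<^sup>2)"

text \<open>A polynomial in \<open>z\<close> and \<open>w\<close> is a polynomial in \<open>w\<close> whose coefficients are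
  polynomials in \<open>z\<close>.\<close>

definition eval2 :: "complex poly poly \<Rightarrow> complex \<Rightarrow> complex \<Rightarrow> complex" where
  "eval2 p z w = poly (poly p [:w:]) z"

definition monom2 :: "nat \<Rightarrow> nat \<Rightarrow> complex poly poly" where
  "monom2 i j = monom (monom 1 i) j"

lemma eval2_monom2: "eval2 (monom2 i j) z w = z ^ i * w ^ j"
  by (simp add: eval2_def monom2_def poly_monom)

text \<open>The Cantor pairing gives \<open>z ^ i * w ^ j\<close> the position
  \<open>prod_encode (j, i) = triangle (i + j) + j\<close>, which is its position in the degree
  lexicographic order; note the swapped components. The two lemmas after the
  definition confirm this.\<close>

definition chi :: "nat \<Rightarrow> complex poly poly" where
  "chi k = (case prod_decode k of (j, i) \<Rightarrow> monom2 i j)"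

lemma chi_prod_encode: "chi (prod_encode (j, i)) = monom2 i j"
  by (simp add: chi_def)

lemma prod_encode_deglex:
  "prod_encode (j, i) < prod_encode (j', i') \<longleftrightarrow>
     i + j < i' + j' \<or> i + j = i' + j' \<and> j < j'"
proof -
  have mono_triangle: "triangle m \<le> triangle n" if "m \<le> n" for m n
    using that by (induction rule: dec_induct) simp_all
  have less: "prod_encode (b, a) < prod_encode (b', a')" if "a + b < a' + b'" for a b a' b'
  proof -
    have "triangle (b + a) + b < triangle (Suc (b + a))"
      by simp
    also have "\<dots> \<le> triangle (b' + a')"
      using that by (intro mono_triangle) simp
    finally show ?thesis
      by (simp add: prod_encode_def)
  qed
  consider "i + j < i' + j'" | "i' + j' < i + j" | "i + j = i' + j'"
    by linarith
  then show ?thesis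
  proof cases
    case 1
    with less[OF 1] show ?thesis by simp
  next
    case 2
    with less[OF 2] show ?thesis by simp
  next
    case 3
    then have "j + i = j' + i'" by simp
    with 3 show ?thesis by (simp add: prod_encode_def)
  qed
qed

definition poly_space :: "nat \<Rightarrow> complex poly poly set" where
  "poly_space n = {p. \<exists>c :: nat \<Rightarrow> complex. p = (\<Sum>k\<le>n. smult [:c k:] (chi k))}"

text \<open>For \<open>f\<close> in \<open>hardy2\<close> not identically zero there is exactly one such \<open>p\<close>.\<close>

definition is_opa :: "nat \<Rightarrow> (complex \<times> complex \<Rightarrow> complex) \<Rightarrow> complex poly poly \<Rightarrow> bool" where
  "is_opa n f p \<longleftrightarrow> p \<in> poly_space n \<and>
     (\<forall>q\<in>poly_space n.
        hardy2_norm (\<lambda>(z, w). eval2 p z w * f (z, w) - 1)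
          \<le> hardy2_norm (\<lambda>(z, w). eval2 q z w * f (z, w) - 1))"

end

theory Submission
  imports Defs "HOL-Complex_Analysis.Complex_Analysis"
begin

text \<open>Suppose \<open>p = (z - \<alpha>) p'\<close> and put \<open>g = p' f\<close>. Since the degree lexicographic order is
  a monomial order, \<open>z p'\<close> again lies in \<open>\<P>\<^sub>n\<close>, so minimality makes \<open>p f - 1\<close> orthogonal
  to \<open>z g\<close>. As \<open>z g\<close> vanishes at the origin, it is orthogonal to \<open>1\<close>, hence to
  \<open>p f = z g - \<alpha> g\<close>, and Pythagoras together with \<open>\<parallel>z g\<parallel> = \<parallel>g\<parallel>\<close> gives
  \<open>(\<bar>\<alpha>\<bar>\<^sup>2 - 1) \<parallel>g\<parallel>\<^sup>2 = \<parallel>p f\<parallel>\<^sup>2\<close>. Finally \<open>p f \<noteq> 0\<close>, because \<open>p f - 1\<close> is orthogonal to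
  \<open>f\<close>, whereas \<open>1\<close> is not. Only real inner products are needed. The variable \<open>w\<close> is treated
  in the same way.\<close>

section \<open>Holomorphic dependence of contour integrals on a parameter\<close>

text \<open>Written out, this is an integral over [0,1] of an integrand that is jointly continuous
  in the parameter and the time.\<close>

lemma continuous_on_contour_integral_param:
  fixes k :: "'a::topological_space \<Rightarrow> complex \<Rightarrow> complex"
  assumes k: "continuous_on (U \<times> path_image \<gamma>) (\<lambda>(z, w). k z w)"
    and \<gamma>: "valid_path \<gamma>" "continuous_on {0..1} (\<lambda>t. vector_derivative \<gamma> (at t))"
  shows "continuous_on U (\<lambda>z. contour_integral \<gamma> (k z))"
proof -
  have "continuous_on {0..1} \<gamma>"
    using \<gamma>(1) by (simp add: valid_path_def piecewise_C1_differentiable_on_def)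
  then have "continuous_on (U \<times> {0..1}) (\<lambda>x. \<gamma> (snd x))"
    by (rule continuous_on_compose2) (auto intro: continuous_intros)
  moreover have "\<gamma> t \<in> path_image \<gamma>" if "t \<in> {0..1}" for t
    using that by (auto simp: path_image_def)
  ultimately have "continuous_on (U \<times> {0..1}) (\<lambda>x. (\<lambda>(z, w). k z w) (fst x, \<gamma> (snd x)))"
    by (intro continuous_on_compose2[OF k] continuous_intros) auto
  moreover have "continuous_on (U \<times> {0..1}) (\<lambda>x. vector_derivative \<gamma> (at (snd x)))"
    by (rule continuous_on_compose2[OF \<gamma>(2)]) (auto intro: continuous_intros)
  ultimately have "continuous_on (U \<times> cbox 0 1)
      (\<lambda>(z, t). k z (\<gamma> t) * vector_derivative \<gamma> (at t))"
    by (auto simp: case_prod_unfold intro: continuous_on_mult)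
  from integral_continuous_on_param[OF this] show ?thesis
    by (simp add: contour_integral_integral)
qed

text \<open>Morera: after exchanging the integrals, the integral around a triangle is the integral
  over \<open>\<gamma>\<close> of the triangle integrals of \<open>k\<close>, and these vanish by
  Cauchy.\<close>

lemma holomorphic_on_contour_integral_param:
  assumes k: "continuous_on (U \<times> path_image \<gamma>) (\<lambda>(z, w). k z w)"
    and hol: "\<And>w. w \<in> path_image \<gamma> \<Longrightarrow> (\<lambda>z. k z w) holomorphic_on U"
    and U: "open U"
    and \<gamma>: "valid_path \<gamma>" "continuous_on {0..1} (\<lambda>t. vector_derivative \<gamma> (at t))"
  shows "(\<lambda>z. contour_integral \<gamma> (k z)) holomorphic_on U"
proof -
  define L where "L a b w = contour_integral (linepath a b) (\<lambda>z. k z w)" for a b w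
  have swap: "contour_integral (linepath a b) (\<lambda>z. contour_integral \<gamma> (k z)) = contour_integral \<gamma> (L a b)"
    and int: "L a b contour_integrable_on \<gamma>" if "closed_segment a b \<subseteq> U" for a b
  proof -
    have k': "continuous_on (closed_segment a b \<times> path_image \<gamma>) (\<lambda>(z, w). k z w)"
      using that by (intro continuous_on_subset[OF k]) auto
    show "contour_integral (linepath a b) (\<lambda>z. contour_integral \<gamma> (k z)) = contour_integral \<gamma> (L a b)"
      unfolding L_def using k' \<gamma> by (intro contour_integral_swap) (auto intro: continuous_intros)
    \<comment> \<open>Continuity of \<open>L a b\<close> makes it integrable along
      \<open>\<gamma>\<close>, so that the three edges can later be added under one
      integral.\<close>
    have "continuous_on (path_image \<gamma>) (L a b)"
      unfolding L_def
      using continuous_on_swap_args[OF k']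
      by (intro continuous_on_contour_integral_param) (auto intro: continuous_intros)
    moreover have "continuous_on {0..1} \<gamma>"
      using \<gamma>(1) by (simp add: valid_path_def piecewise_C1_differentiable_on_def)
    ultimately have "continuous_on {0..1} (\<lambda>t. L a b (\<gamma> t))"
      by (rule continuous_on_compose2) (auto simp: path_image_def)
    then show "L a b contour_integrable_on \<gamma>"
      unfolding contour_integrable_on
      by (intro integrable_continuous_real continuous_on_mult \<gamma>(2))
  qed
  have "(\<lambda>z. contour_integral \<gamma> (k z)) analytic_on U"
  proof (rule Morera_triangle[OF _ U], intro continuous_on_contour_integral_param k \<gamma>, intro impI)
    fix a b c assume abc: "convex hull {a, b, c} \<subseteq> U"
    then have seg: "closed_segment a b \<subseteq> U" "closed_segment b c \<subseteq> U" "closed_segment c a \<subseteq> U"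
      by (meson dual_order.trans segments_subset_convex_hull)+
    have "L a b w + L b c w + L c a w = 0" if w: "w \<in> path_image \<gamma>" for w
    proof -
      have *: "(\<lambda>z. k z w) holomorphic_on convex hull {a, b, c}"
        using hol[OF w] abc by (rule holomorphic_on_subset)
      have "(\<lambda>z. k z w) contour_integrable_on linepath x y" if "closed_segment x y \<subseteq> U" for x y
        using that hol[OF w] by (meson contour_integrable_continuous_linepath continuous_on_subset holomorphic_on_imp_continuous_on)
      with seg contour_integral_unique[OF Cauchy_theorem_triangle[OF *]] show ?thesis
        by (simp add: L_def add.assoc)
    qed
    then have "contour_integral \<gamma> (\<lambda>w. L a b w + L b c w + L c a w) = contour_integral \<gamma> (\<lambda>w. 0)"
      by (rule contour_integral_eq)
    then show "contour_integral (linepath a b) (\<lambda>z. contour_integral \<gamma> (k z)) +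
        contour_integral (linepath b c) (\<lambda>z. contour_integral \<gamma> (k z)) +
        contour_integral (linepath c a) (\<lambda>z. contour_integral \<gamma> (k z)) = 0"
      using seg by (simp add: swap int contour_integral_add contour_integrable_add)
  qed
  then show ?thesis
    by (rule analytic_imp_holomorphic)
qed

section \<open>Taylor coefficients on the bidisk\<close>

lemma holomorphic_bidisk_field:
  assumes "holomorphic_bidisk f" "x \<in> bidisk"
  obtains a b where "(f has_derivative (\<lambda>(h, k). a * h + b * k)) (at x)"
  using assms by (auto simp: holomorphic_bidisk_def)

lemma holomorphic_bidisk_continuous_on:
  assumes "holomorphic_bidisk f"
  shows "continuous_on bidisk f"
  using assms by (intro has_derivative_continuous_on[where f' = "\<lambda>x. SOME d. (f has_derivative d) (at x)"])
    (metis holomorphic_bidisk_field has_derivative_at_withinI someI)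

lemma holomorphic_bidisk_fst:
  assumes f: "holomorphic_bidisk f" and w: "w \<in> ball 0 1"
  shows "(\<lambda>z. f (z, w)) holomorphic_on ball 0 1"
proof (subst holomorphic_on_open, simp, intro ballI)
  fix z :: complex assume "z \<in> ball 0 1"
  with w have "(z, w) \<in> bidisk" by (simp add: bidisk_def)
  then obtain a b where "(f has_derivative (\<lambda>(h, k). a * h + b * k)) (at (z, w))"
    using holomorphic_bidisk_field[OF f] by blast
  from has_derivative_compose[OF has_derivative_Pair[OF has_derivative_ident has_derivative_const] this]
  show "\<exists>f'. ((\<lambda>z. f (z, w)) has_field_derivative f') (at z)"
    by (auto simp: has_field_derivative_def)
qed

lemma holomorphic_bidisk_snd:
  assumes f: "holomorphic_bidisk f" and z: "z \<in> ball 0 1"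
  shows "(\<lambda>w. f (z, w)) holomorphic_on ball 0 1"
proof (subst holomorphic_on_open, simp, intro ballI)
  fix w :: complex assume "w \<in> ball 0 1"
  with z have "(z, w) \<in> bidisk" by (simp add: bidisk_def)
  then obtain a b where "(f has_derivative (\<lambda>(h, k). a * h + b * k)) (at (z, w))"
    using holomorphic_bidisk_field[OF f] by blast
  from has_derivative_compose[OF has_derivative_Pair[OF has_derivative_const has_derivative_ident] this]
  show "\<exists>f'. ((\<lambda>w. f (z, w)) has_field_derivative f') (at w)"
    by (auto simp: has_field_derivative_def)
qed

text \<open>\<open>taylor_coeff\<close> differentiates in w first, and the rules for the outer
  derivative in z require the inner one to be holomorphic in z. Cauchy's formula writes the inner
  derivative as a contour integral depending holomorphically on z.\<close>

lemma holomorphic_bidisk_higher_deriv_snd: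
  assumes f: "holomorphic_bidisk f"
  shows "(\<lambda>z. (deriv ^^ j) (\<lambda>w. f (z, w)) 0) holomorphic_on ball 0 1"
proof -
  \<comment> \<open>The radius 1/2 keeps the circle inside the unit disk and away from the pole at
    0.\<close>
  let ?\<gamma> = "circlepath 0 (1/2)" and ?k = "\<lambda>z w. f (z, w) / w ^ Suc j"
  have "continuous_on (ball 0 1 \<times> path_image ?\<gamma>) (\<lambda>x. f x / snd x ^ Suc j)"
    by (intro continuous_intros continuous_on_subset[OF holomorphic_bidisk_continuous_on[OF f]])
      (auto simp: bidisk_def)
  then have "(\<lambda>z. contour_integral ?\<gamma> (?k z)) holomorphic_on ball 0 1"
    by (intro holomorphic_on_contour_integral_param holomorphic_on_divide holomorphic_bidisk_fst f
        holomorphic_on_const)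
      (auto simp: case_prod_unfold vector_derivative_circlepath intro!: continuous_intros)
  then have "(\<lambda>z. fact j / (2 * pi * \<i>) * contour_integral ?\<gamma> (?k z)) holomorphic_on ball 0 1"
    by (intro holomorphic_intros)
  moreover have "fact j / (2 * pi * \<i>) * contour_integral ?\<gamma> (?k z) = (deriv ^^ j) (\<lambda>w. f (z, w)) 0"
    if "z \<in> ball 0 1" for z
  proof -
    note hol = holomorphic_bidisk_snd[OF f that]
    show ?thesis
      using Cauchy_higher_derivative_integral_circlepath(2)[of 0 "1/2" "\<lambda>w. f (z, w)" 0 j]
        holomorphic_on_subset[OF hol, of "ball 0 (1/2)"]
        continuous_on_subset[OF holomorphic_on_imp_continuous_on[OF hol], of "cball 0 (1/2)"]
      by (auto simp: subset_iff)
  qed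
  ultimately show ?thesis
    by (rule holomorphic_transform)
qed

section \<open>Linearity and shift rules for Taylor coefficients\<close>

lemma higher_deriv_times_ident_0:
  assumes "F holomorphic_on S" "open S" "0 \<in> S"
  shows "(deriv ^^ i) (\<lambda>z. z * F z) 0 = of_nat i * (deriv ^^ (i - 1)) F 0"
proof -
  have "(deriv ^^ i) (\<lambda>z. z * F z) 0 =
      (\<Sum>k = 0..i. of_nat (i choose k) * (deriv ^^ k) (\<lambda>z. z) 0 * (deriv ^^ (i - k)) F 0)"
    using assms by (intro higher_deriv_mult holomorphic_intros)
  \<comment> \<open>At 0, the only nonzero derivative of the identity is the first. For
    \<open>i = 0\<close> the factor \<open>of_nat i\<close> makes the truncated \<open>i - 1\<close>
    harmless.\<close>
  also have "\<dots> = (\<Sum>k = 0..i. if k = 1 then of_nat i * (deriv ^^ (i - 1)) F 0 else 0)"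
    by (intro sum.cong) auto
  also have "\<dots> = of_nat i * (deriv ^^ (i - 1)) F 0"
    by (cases i) auto
  finally show ?thesis .
qed

text \<open>Derivatives at 0 see only the germ there. This is what allows rewriting the inner
  derivative by rules that hold only for z in the disk.\<close>

lemma higher_deriv_cong_ball:
  assumes "\<And>z. z \<in> ball 0 1 \<Longrightarrow> F z = G z"
  shows "(deriv ^^ i) F (0::complex) = (deriv ^^ i) G 0"
  by (rule higher_deriv_cong_ev[OF eventually_mono[OF eventually_nhds_in_open[of "ball 0 1"]]])
    (auto simp: assms)

lemma taylor_coeff_add:
  assumes "holomorphic_bidisk f" "holomorphic_bidisk g"
  shows "taylor_coeff (\<lambda>x. f x + g x) i j = taylor_coeff f i j + taylor_coeff g i j"
proof -
  have "(deriv ^^ i) (\<lambda>z. (deriv ^^ j) (\<lambda>w. f (z, w) + g (z, w)) 0) 0 =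
      (deriv ^^ i) (\<lambda>z. (deriv ^^ j) (\<lambda>w. f (z, w)) 0 + (deriv ^^ j) (\<lambda>w. g (z, w)) 0) 0"
    by (intro higher_deriv_cong_ball higher_deriv_add[where S = "ball 0 1"] holomorphic_bidisk_snd assms) auto
  also have "\<dots> = (deriv ^^ i) (\<lambda>z. (deriv ^^ j) (\<lambda>w. f (z, w)) 0) 0 + (deriv ^^ i) (\<lambda>z. (deriv ^^ j) (\<lambda>w. g (z, w)) 0) 0"
    by (intro higher_deriv_add[where S = "ball 0 1"] holomorphic_bidisk_higher_deriv_snd assms) auto
  finally show ?thesis
    by (simp add: taylor_coeff_def add_divide_distrib)
qed

lemma taylor_coeff_cmult:
  assumes "holomorphic_bidisk f"
  shows "taylor_coeff (\<lambda>x. c * f x) i j = c * taylor_coeff f i j"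
proof -
  have "(deriv ^^ i) (\<lambda>z. (deriv ^^ j) (\<lambda>w. c * f (z, w)) 0) 0 =
      (deriv ^^ i) (\<lambda>z. c * (deriv ^^ j) (\<lambda>w. f (z, w)) 0) 0"
    by (intro higher_deriv_cong_ball higher_deriv_cmult[where A = "ball 0 1"] holomorphic_bidisk_snd assms) auto
  also have "\<dots> = c * (deriv ^^ i) (\<lambda>z. (deriv ^^ j) (\<lambda>w. f (z, w)) 0) 0"
    by (intro higher_deriv_cmult[where A = "ball 0 1"] holomorphic_bidisk_higher_deriv_snd assms) auto
  finally show ?thesis
    by (simp add: taylor_coeff_def)
qed

text \<open>The Leibniz factor \<open>i\<close> is absorbed by \<open>fact i\<close>, which shifts
  the normalisation from \<open>i\<close> to \<open>i - 1\<close>.\<close>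

lemma of_nat_div_fact: "of_nat i * x / (fact i * y) = (if i = 0 then 0 else x / (fact (i - 1) * y :: complex))"
  by (cases i) (simp_all add: field_simps del: of_nat_Suc)

text \<open>For the inner derivative z is a constant; the outer one produces the shift by the
  Leibniz rule.\<close>

lemma taylor_coeff_times_fst:
  assumes "holomorphic_bidisk f"
  shows "taylor_coeff (\<lambda>x. fst x * f x) i j = (if i = 0 then 0 else taylor_coeff f (i - 1) j)"
proof -
  have "(deriv ^^ i) (\<lambda>z. (deriv ^^ j) (\<lambda>w. z * f (z, w)) 0) 0 =
      (deriv ^^ i) (\<lambda>z. z * (deriv ^^ j) (\<lambda>w. f (z, w)) 0) 0"
    by (intro higher_deriv_cong_ball higher_deriv_cmult[where A = "ball 0 1"] holomorphic_bidisk_snd assms) auto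
  also have "\<dots> = of_nat i * (deriv ^^ (i - 1)) (\<lambda>z. (deriv ^^ j) (\<lambda>w. f (z, w)) 0) 0"
    by (intro higher_deriv_times_ident_0[where S = "ball 0 1"] holomorphic_bidisk_higher_deriv_snd assms) auto
  finally show ?thesis
    by (simp add: taylor_coeff_def of_nat_div_fact)
qed

text \<open>Here the inner derivative produces the shift, and its factor \<open>of_nat j\<close> is
  a constant for the outer one.\<close>

lemma taylor_coeff_times_snd:
  assumes "holomorphic_bidisk f"
  shows "taylor_coeff (\<lambda>x. snd x * f x) i j = (if j = 0 then 0 else taylor_coeff f i (j - 1))"
proof -
  have "(deriv ^^ i) (\<lambda>z. (deriv ^^ j) (\<lambda>w. w * f (z, w)) 0) 0 =
      (deriv ^^ i) (\<lambda>z. of_nat j * (deriv ^^ (j - 1)) (\<lambda>w. f (z, w)) 0) 0"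
    by (intro higher_deriv_cong_ball higher_deriv_times_ident_0[where S = "ball 0 1"] holomorphic_bidisk_snd assms) auto
  also have "\<dots> = of_nat j * (deriv ^^ i) (\<lambda>z. (deriv ^^ (j - 1)) (\<lambda>w. f (z, w)) 0) 0"
    by (intro higher_deriv_cmult[where A = "ball 0 1"] holomorphic_bidisk_higher_deriv_snd assms) auto
  finally show ?thesis
    using of_nat_div_fact[of j _ "fact i"] by (simp add: taylor_coeff_def mult.commute[of "fact i"])
qed

lemma taylor_coeff_const: "taylor_coeff (\<lambda>x. c) i j = (if i = 0 \<and> j = 0 then c else 0)"
  by (auto simp: taylor_coeff_def)

section \<open>Closure properties of holomorphic functions on the bidisk\<close>

lemma holomorphic_bidisk_const: "holomorphic_bidisk (\<lambda>x. c)"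
  unfolding holomorphic_bidisk_def
  by (intro ballI exI[of _ 0]) (auto simp: case_prod_unfold intro!: derivative_eq_intros)

lemma holomorphic_bidisk_fst_snd: "holomorphic_bidisk fst" "holomorphic_bidisk snd"
  unfolding holomorphic_bidisk_def
  by (intro ballI exI[of _ 0] exI[of _ 1], force simp: case_prod_unfold intro!: derivative_eq_intros)+

lemma holomorphic_bidisk_add:
  assumes "holomorphic_bidisk f" "holomorphic_bidisk g"
  shows "holomorphic_bidisk (\<lambda>x. f x + g x)"
  unfolding holomorphic_bidisk_def
proof
  fix x assume x: "x \<in> bidisk"
  obtain a b where 1: "(f has_derivative (\<lambda>(h, k). a * h + b * k)) (at x)"
    using holomorphic_bidisk_field[OF assms(1) x] by blast
  obtain c d where 2: "(g has_derivative (\<lambda>(h, k). c * h + d * k)) (at x)"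
    using holomorphic_bidisk_field[OF assms(2) x] by blast
  show "\<exists>a b. ((\<lambda>x. f x + g x) has_derivative (\<lambda>(h, k). a * h + b * k)) (at x)"
    by (rule exI[of _ "a + c"], rule exI[of _ "b + d"])
      (rule has_derivative_eq_rhs[OF has_derivative_add[OF 1 2]], auto simp: algebra_simps)
qed

lemma holomorphic_bidisk_mult:
  assumes "holomorphic_bidisk f" "holomorphic_bidisk g"
  shows "holomorphic_bidisk (\<lambda>x. f x * g x)"
  unfolding holomorphic_bidisk_def
proof
  fix x assume x: "x \<in> bidisk"
  obtain a b where 1: "(f has_derivative (\<lambda>(h, k). a * h + b * k)) (at x)"
    using holomorphic_bidisk_field[OF assms(1) x] by blast
  obtain c d where 2: "(g has_derivative (\<lambda>(h, k). c * h + d * k)) (at x)"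
    using holomorphic_bidisk_field[OF assms(2) x] by blast
  show "\<exists>a b. ((\<lambda>x. f x * g x) has_derivative (\<lambda>(h, k). a * h + b * k)) (at x)"
    by (rule exI[of _ "f x * c + a * g x"], rule exI[of _ "f x * d + b * g x"])
      (rule has_derivative_eq_rhs[OF has_derivative_mult[OF 1 2]], auto simp: algebra_simps)
qed

section \<open>Square-summable families\<close>

context
  fixes a b :: "'i \<Rightarrow> 'a::real_inner"
  assumes a: "(\<lambda>x. (norm (a x))\<^sup>2) summable_on UNIV" and b: "(\<lambda>x. (norm (b x))\<^sup>2) summable_on UNIV"
begin

text \<open>Cauchy-Schwarz in each term and the inequality between geometric and arithmetic mean
  give a summable majorant.\<close>

lemma summable_on_inner: "(\<lambda>x. a x \<bullet> b x) summable_on UNIV"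
proof -
  have "\<bar>a x \<bullet> b x\<bar> \<le> (norm (a x))\<^sup>2 + (norm (b x))\<^sup>2" for x
  proof -
    have "2 * (norm (a x) * norm (b x)) \<le> (norm (a x))\<^sup>2 + (norm (b x))\<^sup>2"
      using sum_squares_bound[of "norm (a x)" "norm (b x)"] by simp
    moreover have "\<bar>a x \<bullet> b x\<bar> \<le> norm (a x) * norm (b x)"
      by (rule Cauchy_Schwarz_ineq2)
    ultimately show ?thesis
      using mult_nonneg_nonneg[of "norm (a x)" "norm (b x)"] by linarith
  qed
  then have "(\<lambda>x. \<bar>a x \<bullet> b x\<bar>) summable_on UNIV"
    by (intro summable_on_comparison_test[OF summable_on_add[OF a b]]) auto
  then show ?thesis
    using abs_summable_summable[of "\<lambda>x. a x \<bullet> b x" UNIV] by simp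
qed

lemma power2_norm_add_scaleR:
  "(norm (a x + t *\<^sub>R b x))\<^sup>2 = (norm (a x))\<^sup>2 + (2 * t) * (a x \<bullet> b x) + t\<^sup>2 * (norm (b x))\<^sup>2"
  unfolding power2_norm_eq_inner
  by (simp add: inner_simps inner_commute power2_eq_square algebra_simps)

lemma summable_on_norm_add_scaleR: "(\<lambda>x. (norm (a x + t *\<^sub>R b x))\<^sup>2) summable_on UNIV"
  unfolding power2_norm_add_scaleR
  by (intro summable_on_add summable_on_cmult_right a b summable_on_inner)

lemma infsum_norm_add_scaleR:
  "(\<Sum>\<^sub>\<infinity>x. (norm (a x + t *\<^sub>R b x))\<^sup>2) =
    (\<Sum>\<^sub>\<infinity>x. (norm (a x))\<^sup>2) + 2 * t * (\<Sum>\<^sub>\<infinity>x. a x \<bullet> b x) + t\<^sup>2 * (\<Sum>\<^sub>\<infinity>x. (norm (b x))\<^sup>2)"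
  unfolding power2_norm_add_scaleR
  by (simp add: infsum_add infsum_cmult_right summable_on_add summable_on_cmult_right a b summable_on_inner)

text \<open>A quadratic \<open>2 * t * I + t\<^sup>2 * N\<close> that is nonnegative for all real
  \<open>t\<close> has no linear term.\<close>

lemma infsum_inner_eq_0_if_minimal:
  assumes "\<And>t. (\<Sum>\<^sub>\<infinity>x. (norm (a x))\<^sup>2) \<le> (\<Sum>\<^sub>\<infinity>x. (norm (a x + t *\<^sub>R b x))\<^sup>2)"
  shows "(\<Sum>\<^sub>\<infinity>x. a x \<bullet> b x) = 0"
proof (rule ccontr)
  define I where "I = (\<Sum>\<^sub>\<infinity>x. a x \<bullet> b x)"
  define N where "N = (\<Sum>\<^sub>\<infinity>x. (norm (b x))\<^sup>2)"
  assume "(\<Sum>\<^sub>\<infinity>x. a x \<bullet> b x) \<noteq> 0"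
  then have I: "0 < I\<^sup>2" by (simp add: I_def)
  have N: "0 \<le> N" unfolding N_def by (intro infsum_nonneg) simp
  have "0 \<le> 2 * t * I + t\<^sup>2 * N" for t
    using assms[of t] by (simp add: infsum_norm_add_scaleR I_def N_def)
  \<comment> \<open>The value to be inserted is \<open>t = - I / (N + 1)\<close>, with
    \<open>N + 1\<close> because \<open>N\<close> may be 0. The factor clears its
    denominator.\<close>
  then have "0 \<le> (2 * t * I + t\<^sup>2 * N) * (N + 1)\<^sup>2" for t
    by simp
  also have "(2 * t * I + t\<^sup>2 * N) * (N + 1)\<^sup>2 = 2 * (t * (N + 1)) * I * (N + 1) + (t * (N + 1))\<^sup>2 * N" for t
    by (simp add: algebra_simps power2_eq_square)
  finally have "0 \<le> 2 * (t * (N + 1)) * I * (N + 1) + (t * (N + 1))\<^sup>2 * N" for t .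
  from this[of "- I / (N + 1)"] have "0 \<le> 2 * (- I) * I * (N + 1) + (- I)\<^sup>2 * N"
    using N by simp
  also have "\<dots> = - (I\<^sup>2 * (N + 2))"
    by (simp add: algebra_simps power2_eq_square)
  finally have "0 \<le> - (I\<^sup>2 * (N + 2))" .
  moreover have "0 < I\<^sup>2 * (N + 2)" using I N by simp
  ultimately show False by linarith
qed

end

lemma infsum_single:
  fixes a :: "'i \<Rightarrow> real"
  assumes "\<And>x. x \<noteq> c \<Longrightarrow> a x = 0"
  shows "infsum a UNIV = a c"
proof -
  have "infsum a UNIV = infsum a {c}"
    by (rule infsum_cong_neutral) (auto simp: assms)
  then show ?thesis by simp
qed

section \<open>The Hardy space on the bidisk\<close>

text \<open>Uncurried, so that the results on square-summable families over an arbitrary index type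
  apply.\<close>

definition taylor_coeffs :: "(complex \<times> complex \<Rightarrow> complex) \<Rightarrow> nat \<times> nat \<Rightarrow> complex" where
  "taylor_coeffs f = (\<lambda>(i, j). taylor_coeff f i j)"

lemma hardy2_iff:
  "f \<in> hardy2 \<longleftrightarrow> holomorphic_bidisk f \<and> (\<lambda>x. (norm (taylor_coeffs f x))\<^sup>2) summable_on UNIV"
  by (simp add: hardy2_def taylor_coeffs_def case_prod_unfold)

lemma hardy2_norm_eq: "hardy2_norm f = sqrt (\<Sum>\<^sub>\<infinity>x. (norm (taylor_coeffs f x))\<^sup>2)"
  by (simp add: hardy2_norm_def taylor_coeffs_def case_prod_unfold)

lemma hardy2_holomorphic: "f \<in> hardy2 \<Longrightarrow> holomorphic_bidisk f"
  and hardy2_summable: "f \<in> hardy2 \<Longrightarrow> (\<lambda>x. (norm (taylor_coeffs f x))\<^sup>2) summable_on UNIV"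
  by (simp_all add: hardy2_iff)

lemma taylor_coeffs_add:
  "f \<in> hardy2 \<Longrightarrow> g \<in> hardy2 \<Longrightarrow> taylor_coeffs (\<lambda>x. f x + g x) = (\<lambda>x. taylor_coeffs f x + taylor_coeffs g x)"
  by (auto simp: taylor_coeffs_def taylor_coeff_add hardy2_holomorphic)

lemma taylor_coeffs_cmult: "f \<in> hardy2 \<Longrightarrow> taylor_coeffs (\<lambda>x. c * f x) = (\<lambda>x. c * taylor_coeffs f x)"
  by (auto simp: taylor_coeffs_def taylor_coeff_cmult hardy2_holomorphic)

lemma taylor_coeffs_const: "taylor_coeffs (\<lambda>x. c) = (\<lambda>x. if x = (0, 0) then c else 0)"
  by (auto simp: taylor_coeffs_def taylor_coeff_const)

lemma taylor_coeffs_0: "taylor_coeffs f (0, 0) = f (0, 0)"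
  by (simp add: taylor_coeffs_def taylor_coeff_def)

lemma taylor_coeffs_times_fst:
  "f \<in> hardy2 \<Longrightarrow> taylor_coeffs (\<lambda>x. fst x * f x) (i, j) = (if i = 0 then 0 else taylor_coeffs f (i - 1, j))"
  by (simp add: taylor_coeffs_def taylor_coeff_times_fst hardy2_holomorphic)

lemma taylor_coeffs_times_snd:
  "f \<in> hardy2 \<Longrightarrow> taylor_coeffs (\<lambda>x. snd x * f x) (i, j) = (if j = 0 then 0 else taylor_coeffs f (i, j - 1))"
  by (simp add: taylor_coeffs_def taylor_coeff_times_snd hardy2_holomorphic)

text \<open>Stated as an equivalence of \<open>has_sum\<close>, it transfers summability and the
  value of the sum together.\<close>

lemma has_sum_shift:
  fixes a b :: "'i \<Rightarrow> real"
  assumes "inj s" "\<And>x. b (s x) = a x" "\<And>y. y \<notin> range s \<Longrightarrow> b y = 0"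
  shows "(b has_sum l) UNIV \<longleftrightarrow> (a has_sum l) UNIV"
proof -
  have "(b has_sum l) UNIV \<longleftrightarrow> (b has_sum l) (range s)"
    by (rule has_sum_cong_neutral) (auto simp: assms(3))
  also have "\<dots> \<longleftrightarrow> (a has_sum l) UNIV"
    by (simp add: has_sum_reindex[OF assms(1)] o_def assms(2))
  finally show ?thesis .
qed

lemma has_sum_norm_taylor_coeffs_times_fst:
  assumes "f \<in> hardy2"
  shows "((\<lambda>x. (norm (taylor_coeffs (\<lambda>x. fst x * f x) x))\<^sup>2) has_sum l) UNIV \<longleftrightarrow>
    ((\<lambda>x. (norm (taylor_coeffs f x))\<^sup>2) has_sum l) UNIV"
proof (rule has_sum_shift[where s = "\<lambda>(i, j). (Suc i, j)"])
  fix y :: "nat \<times> nat" assume *: "y \<notin> range (\<lambda>(i, j). (Suc i, j))"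
  obtain i j where y: "y = (i, j)" by fastforce
  with * have "i = 0" by (cases i) auto
  then show "(norm (taylor_coeffs (\<lambda>x. fst x * f x) y))\<^sup>2 = 0"
    by (simp add: y taylor_coeffs_times_fst assms)
qed (auto simp: taylor_coeffs_times_fst assms inj_def)

lemma has_sum_norm_taylor_coeffs_times_snd:
  assumes "f \<in> hardy2"
  shows "((\<lambda>x. (norm (taylor_coeffs (\<lambda>x. snd x * f x) x))\<^sup>2) has_sum l) UNIV \<longleftrightarrow>
    ((\<lambda>x. (norm (taylor_coeffs f x))\<^sup>2) has_sum l) UNIV"
proof (rule has_sum_shift[where s = "\<lambda>(i, j). (i, Suc j)"])
  fix y :: "nat \<times> nat" assume *: "y \<notin> range (\<lambda>(i, j). (i, Suc j))"
  obtain i j where y: "y = (i, j)" by fastforce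
  with * have "j = 0" by (cases j) auto
  then show "(norm (taylor_coeffs (\<lambda>x. snd x * f x) y))\<^sup>2 = 0"
    by (simp add: y taylor_coeffs_times_snd assms)
qed (auto simp: taylor_coeffs_times_snd assms inj_def)

text \<open>Multiplication by z moves the coefficients injectively and fills the remaining places
  with zeros, hence is an isometry.\<close>

lemma hardy2_times_fst:
  assumes "f \<in> hardy2"
  shows "(\<lambda>x. fst x * f x) \<in> hardy2" and "hardy2_norm (\<lambda>x. fst x * f x) = hardy2_norm f"
proof -
  have *: "((\<lambda>x. (norm (taylor_coeffs (\<lambda>x. fst x * f x) x))\<^sup>2) has_sum
      (\<Sum>\<^sub>\<infinity>x. (norm (taylor_coeffs f x))\<^sup>2)) UNIV"
    by (rule has_sum_norm_taylor_coeffs_times_fst[OF assms, THEN iffD2, OF has_sum_infsum[OF hardy2_summable[OF assms]]])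
  show "(\<lambda>x. fst x * f x) \<in> hardy2"
    unfolding hardy2_iff
    by (intro conjI has_sum_imp_summable[OF *] holomorphic_bidisk_mult holomorphic_bidisk_fst_snd
      hardy2_holomorphic assms)
  show "hardy2_norm (\<lambda>x. fst x * f x) = hardy2_norm f"
    by (simp only: hardy2_norm_eq infsumI[OF *])
qed

lemma hardy2_times_snd:
  assumes "f \<in> hardy2"
  shows "(\<lambda>x. snd x * f x) \<in> hardy2" and "hardy2_norm (\<lambda>x. snd x * f x) = hardy2_norm f"
proof -
  have *: "((\<lambda>x. (norm (taylor_coeffs (\<lambda>x. snd x * f x) x))\<^sup>2) has_sum
      (\<Sum>\<^sub>\<infinity>x. (norm (taylor_coeffs f x))\<^sup>2)) UNIV"
    by (rule has_sum_norm_taylor_coeffs_times_snd[OF assms, THEN iffD2, OF has_sum_infsum[OF hardy2_summable[OF assms]]])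
  show "(\<lambda>x. snd x * f x) \<in> hardy2"
    unfolding hardy2_iff
    by (intro conjI has_sum_imp_summable[OF *] holomorphic_bidisk_mult holomorphic_bidisk_fst_snd
      hardy2_holomorphic assms)
  show "hardy2_norm (\<lambda>x. snd x * f x) = hardy2_norm f"
    by (simp only: hardy2_norm_eq infsumI[OF *])
qed

section \<open>Closure of the Hardy space under polynomial multiples\<close>

lemma hardy2_const: "(\<lambda>x. c) \<in> hardy2"
proof -
  have "(\<lambda>x. (norm (taylor_coeffs (\<lambda>x. c) x))\<^sup>2) summable_on {(0, 0)}" by simp
  also have "?this \<longleftrightarrow> (\<lambda>x. (norm (taylor_coeffs (\<lambda>x. c) x))\<^sup>2) summable_on UNIV"
    by (rule summable_on_cong_neutral) (auto simp: taylor_coeffs_const)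
  finally show ?thesis
    by (simp add: hardy2_iff holomorphic_bidisk_const)
qed

lemma hardy2_add: "f \<in> hardy2 \<Longrightarrow> g \<in> hardy2 \<Longrightarrow> (\<lambda>x. f x + g x) \<in> hardy2"
  using summable_on_norm_add_scaleR[where t = 1, OF hardy2_summable hardy2_summable, of f g]
  by (simp add: hardy2_iff[of "\<lambda>x. f x + g x"] taylor_coeffs_add holomorphic_bidisk_add hardy2_holomorphic)

lemma hardy2_cmult: "f \<in> hardy2 \<Longrightarrow> (\<lambda>x. c * f x) \<in> hardy2"
  by (simp add: hardy2_iff[of "\<lambda>x. c * f x"] taylor_coeffs_cmult holomorphic_bidisk_mult holomorphic_bidisk_const
    hardy2_holomorphic norm_mult power_mult_distrib summable_on_cmult_right hardy2_summable)

lemma eval2_0 [simp]: "eval2 0 z w = 0"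
  and eval2_pCons [simp]: "eval2 (pCons a p) z w = poly a z + w * eval2 p z w"
  and eval2_add [simp]: "eval2 (p + q) z w = eval2 p z w + eval2 q z w"
  and eval2_diff [simp]: "eval2 (p - q) z w = eval2 p z w - eval2 q z w"
  and eval2_mult [simp]: "eval2 (p * q) z w = eval2 p z w * eval2 q z w"
  and eval2_smult [simp]: "eval2 (smult a p) z w = poly a z * eval2 p z w"
  by (simp_all add: eval2_def)

lemma hardy2_poly_mult: "f \<in> hardy2 \<Longrightarrow> (\<lambda>x. poly a (fst x) * f x) \<in> hardy2"
proof (induction a)
  case 0
  then show ?case using hardy2_const[of 0] by simp
next
  case (pCons c a)
  then show ?case
    using hardy2_add[OF hardy2_cmult[OF pCons.prems, of c] hardy2_times_fst(1)[OF pCons.IH]]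
    by (simp add: algebra_simps)
qed

text \<open>Horner's scheme in w; the coefficients, polynomials in z, are covered by
  \<open>hardy2_poly_mult\<close>.\<close>

lemma hardy2_eval2_mult: "f \<in> hardy2 \<Longrightarrow> (\<lambda>x. eval2 p (fst x) (snd x) * f x) \<in> hardy2"
proof (induction p)
  case 0
  then show ?case using hardy2_const[of 0] by simp
next
  case (pCons a p)
  then show ?case
    using hardy2_add[OF hardy2_poly_mult[OF pCons.prems, of a] hardy2_times_snd(1)[OF pCons.IH]]
    by (simp add: algebra_simps)
qed

section \<open>Polynomials in degree lexicographic order\<close>

lemma eval2_eq_0_imp:
  assumes "\<And>z w. eval2 p z w = 0"
  shows "p = 0"
proof (rule poly_eqI)
  fix j
  have "poly (coeff p j) z = 0" for z
  proof -
    \<comment> \<open>With z fixed, this is a polynomial in w alone; vanishing everywhere, it has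
      zero coefficients, and these are the values at z of the coefficients of
      \<open>p\<close>.\<close>
    have "poly (map_poly (\<lambda>a. poly a z) p) w = eval2 p z w" for w
      by (induction p) (simp_all add: map_poly_pCons)
    then have "map_poly (\<lambda>a. poly a z) p = 0"
      using assms by (simp flip: poly_all_0_iff_0)
    then have "coeff (map_poly (\<lambda>a. poly a z) p) j = 0" by simp
    then show ?thesis by (simp add: coeff_map_poly)
  qed
  then show "coeff p j = coeff 0 j"
    by (simp flip: poly_all_0_iff_0)
qed

text \<open>This turns a factorisation given by values into an identity of polynomials, whose
  coefficients can be compared.\<close>

lemma eval2_inject:
  assumes "\<And>z w. eval2 p z w = eval2 q z w"
  shows "p = q"
  using eval2_eq_0_imp[of "p - q"] assms by simp

text \<open>The outer polynomial is in w, so \<open>j\<close> is looked up first; the arguments stay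
  in the order of the exponents of z and w.\<close>

definition coeff2 :: "'a::zero poly poly \<Rightarrow> nat \<Rightarrow> nat \<Rightarrow> 'a" where
  "coeff2 p i j = coeff (coeff p j) i"

lemma coeff2_chi:
  "coeff2 (chi k) i j = (if prod_encode (j, i) = k then 1 else 0)"
proof -
  obtain j' i' where k: "k = prod_encode (j', i')"
    by (metis prod_decode_inverse surj_pair)
  show ?thesis
    by (auto simp: k chi_prod_encode monom2_def coeff2_def)
qed

text \<open>The \<open>chi k\<close> are distinct monomials, so membership only says which
  coefficients vanish.\<close>

lemma poly_space_iff:
  "p \<in> poly_space n \<longleftrightarrow> (\<forall>i j. n < prod_encode (j, i) \<longrightarrow> coeff2 p i j = 0)"
proof -
  have sum: "coeff2 (\<Sum>k\<le>n. smult [:c k:] (chi k)) i j =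
      (if prod_encode (j, i) \<le> n then c (prod_encode (j, i)) else 0)" for c i j
  proof -
    have "coeff2 (\<Sum>k\<le>n. smult [:c k:] (chi k)) i j = (\<Sum>k\<le>n. c k * coeff2 (chi k) i j)"
      by (simp add: coeff2_def coeff_sum)
    then show ?thesis
      by (simp add: coeff2_chi if_distrib cong: if_cong)
  qed
  show ?thesis
  proof
    assume "p \<in> poly_space n"
    then show "\<forall>i j. n < prod_encode (j, i) \<longrightarrow> coeff2 p i j = 0"
      by (auto simp: poly_space_def sum)
  next
    assume *: "\<forall>i j. n < prod_encode (j, i) \<longrightarrow> coeff2 p i j = 0"
    define c where "c k = (case prod_decode k of (j, i) \<Rightarrow> coeff2 p i j)" for k
    have "p = (\<Sum>k\<le>n. smult [:c k:] (chi k))"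
    proof (intro poly_eqI)
      fix i j
      have "coeff2 p i j = coeff2 (\<Sum>k\<le>n. smult [:c k:] (chi k)) i j"
        unfolding sum using * by (simp add: c_def)
      then show "coeff (coeff p j) i = coeff (coeff (\<Sum>k\<le>n. smult [:c k:] (chi k)) j) i"
        by (simp add: coeff2_def)
    qed
    then show "p \<in> poly_space n"
      by (auto simp: poly_space_def)
  qed
qed

lemma poly_space_add: "p \<in> poly_space n \<Longrightarrow> q \<in> poly_space n \<Longrightarrow> p + q \<in> poly_space n"
  by (auto simp: poly_space_iff coeff2_def)

lemma poly_space_smult: "p \<in> poly_space n \<Longrightarrow> smult [:c:] p \<in> poly_space n"
  by (auto simp: poly_space_iff coeff2_def)

lemma poly_space_const: "[:[:c:]:] \<in> poly_space n"
  by (auto simp: poly_space_iff coeff2_def coeff_pCons prod_encode_def split: nat.split)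

text \<open>Where the coefficients of \<open>(z - \<alpha>) p\<close> vanish, \<open>p\<^sub>i\<^sub>j = \<alpha> p\<^sub>i\<^sub>+\<^sub>1\<^sub>j\<close>. So a nonzero coefficient of
  \<open>z p\<close> beyond \<open>\<chi>\<^sub>n\<close> would make infinitely many coefficients of \<open>p\<close> nonzero.\<close>

lemma poly_space_times_fst:
  assumes "[:[:- \<alpha>, 1:]:] * p \<in> poly_space n"
  shows "[:[:0, 1:]:] * p \<in> poly_space n"
proof -
  have rec: "coeff2 p i j = \<alpha> * coeff2 p (Suc i) j" if "n < prod_encode (j, Suc i)" for i j
    using assms[unfolded poly_space_iff, rule_format, OF that] by (simp add: coeff2_def)
  \<comment> \<open>Raising the exponent of z moves a monomial up in the order, so
    \<open>rec\<close> can be iterated.\<close>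
  have step: "n < prod_encode (j, Suc i) \<Longrightarrow> n < prod_encode (j, Suc (Suc i))" for i j
    by (erule less_trans) (simp add: prod_encode_deglex)
  have "coeff2 p i j = 0" if n: "n < prod_encode (j, Suc i)" for i j
  proof (rule ccontr)
    assume nz: "coeff2 p i j \<noteq> 0"
    have "n < prod_encode (j, Suc (i + k)) \<and> coeff2 p (i + k) j \<noteq> 0" for k
    proof (induction k)
      case (Suc k)
      then show ?case using rec[of j "i + k"] step[of j "i + k"] by auto
    qed (use n nz in auto)
    \<comment> \<open>This index exceeds the degree in z of the coefficient of
      \<open>w ^ j\<close>.\<close>
    from this[of "Suc (degree (coeff p j))"] show False
      by (simp add: coeff2_def coeff_eq_0)
  qed
  then show ?thesis
    by (auto simp: poly_space_iff coeff2_def coeff_pCons split: nat.split)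
qed

text \<open>As for \<open>poly_space_times_fst\<close>, with the recurrence running in the exponent
  of w and stopped by the degree in w.\<close>

lemma poly_space_times_snd:
  assumes "[:[:- \<beta>:], 1:] * p \<in> poly_space n"
  shows "[:0, 1:] * p \<in> poly_space n"
proof -
  have rec: "coeff2 p i j = \<beta> * coeff2 p i (Suc j)" if "n < prod_encode (Suc j, i)" for i j
    using assms[unfolded poly_space_iff, rule_format, OF that] by (simp add: coeff2_def)
  have step: "n < prod_encode (Suc j, i) \<Longrightarrow> n < prod_encode (Suc (Suc j), i)" for i j
    by (erule less_trans) (simp add: prod_encode_deglex)
  have "coeff2 p i j = 0" if n: "n < prod_encode (Suc j, i)" for i j
  proof (rule ccontr)
    assume nz: "coeff2 p i j \<noteq> 0"
    have "n < prod_encode (Suc (j + k), i) \<and> coeff2 p i (j + k) \<noteq> 0" for k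
    proof (induction k)
      case (Suc k)
      then show ?case using rec[of "j + k" i] step[of "j + k" i] by auto
    qed (use n nz in auto)
    from this[of "Suc (degree p)"] show False
      by (simp add: coeff2_def coeff_eq_0)
  qed
  then show ?thesis
    by (auto simp: poly_space_iff coeff2_def coeff_pCons split: nat.split)
qed

section \<open>Optimal polynomial approximants\<close>

text \<open>First-order optimality: \<open>p + t q\<close> is a competitor for every real
  \<open>t\<close>, and its residual is that of \<open>p\<close> plus \<open>t\<close> times
  \<open>q f\<close>.\<close>

lemma is_opa_orthogonal:
  assumes f: "f \<in> hardy2" and p: "is_opa n f p" and q: "q \<in> poly_space n"
  shows "(\<Sum>\<^sub>\<infinity>x. taylor_coeffs (\<lambda>(z, w). eval2 p z w * f (z, w) - 1) x \<bullet>
    taylor_coeffs (\<lambda>(z, w). eval2 q z w * f (z, w)) x) = 0"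
proof (rule infsum_inner_eq_0_if_minimal)
  let ?r = "\<lambda>p. \<lambda>(z, w). eval2 p z w * f (z, w) - 1" and ?q = "\<lambda>(z, w). eval2 q z w * f (z, w)"
  have r: "?r p \<in> hardy2" for p
    using hardy2_add[OF hardy2_eval2_mult[OF f, of p] hardy2_const[of "-1"]] by (simp add: case_prod_unfold)
  have q': "?q \<in> hardy2"
    using hardy2_eval2_mult[OF f, of q] by (simp add: case_prod_unfold)
  show "(\<lambda>x. (norm (taylor_coeffs (?r p) x))\<^sup>2) summable_on UNIV" "(\<lambda>x. (norm (taylor_coeffs ?q x))\<^sup>2) summable_on UNIV"
    using r q' by (simp_all add: hardy2_summable)
  fix t :: real
  have eq: "?r (p + smult [:of_real t:] q) = (\<lambda>x. ?r p x + of_real t * ?q x)"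
    by (auto simp: algebra_simps)
  have "p + smult [:of_real t:] q \<in> poly_space n"
    using p q by (intro poly_space_add poly_space_smult) (auto simp: is_opa_def)
  with p have "hardy2_norm (?r p) \<le> hardy2_norm (?r (p + smult [:of_real t:] q))"
    unfolding is_opa_def by blast
  then show "(\<Sum>\<^sub>\<infinity>x. (norm (taylor_coeffs (?r p) x))\<^sup>2) \<le>
      (\<Sum>\<^sub>\<infinity>x. (norm (taylor_coeffs (?r p) x + t *\<^sub>R taylor_coeffs ?q x))\<^sup>2)"
    unfolding hardy2_norm_eq eq
    by (simp add: taylor_coeffs_add[OF r hardy2_cmult[OF q']] taylor_coeffs_cmult[OF q'] scaleR_conv_of_real)
qed

text \<open>Both variables at once: \<open>e\<close> stands for a coordinate function, of which only
  the zero at the origin and the isometry property enter, and \<open>r\<close> is the polynomial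
  \<open>e p'\<close>.\<close>

lemma is_opa_linear_factor:
  fixes e :: "complex \<times> complex \<Rightarrow> complex"
  assumes f: "f \<in> hardy2" "f (0, 0) \<noteq> 0" and p: "is_opa n f p"
    and e: "e (0, 0) = 0"
      "\<And>g. g \<in> hardy2 \<Longrightarrow> (\<lambda>x. e x * g x) \<in> hardy2"
      "\<And>g. g \<in> hardy2 \<Longrightarrow> hardy2_norm (\<lambda>x. e x * g x) = hardy2_norm g"
    and r: "r \<in> poly_space n"
    and eval: "\<And>z w. eval2 p z w = (e (z, w) - \<alpha>) * eval2 p' z w"
      "\<And>z w. eval2 r z w = e (z, w) * eval2 p' z w"
  shows "cmod \<alpha> > 1"
proof -
  \<comment> \<open>These are \<open>g = p' f\<close>, \<open>A = p f\<close> and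
    \<open>B = e p' f\<close>, so that \<open>A = B - \<alpha> g\<close>; \<open>N\<close> is the
    squared norm.\<close>
  define g where "g = (\<lambda>x. eval2 p' (fst x) (snd x) * f x)"
  define A where "A = (\<lambda>x. eval2 p (fst x) (snd x) * f x)"
  define B where "B = (\<lambda>x. e x * g x)"
  define N where "N h = (\<Sum>\<^sub>\<infinity>x. (norm (taylor_coeffs h x))\<^sup>2)" for h
  have g: "g \<in> hardy2" and A: "A \<in> hardy2"
    unfolding g_def A_def by (simp_all add: hardy2_eval2_mult f)
  have B: "B \<in> hardy2" unfolding B_def by (rule e(2)[OF g])
  have N_nonneg: "0 \<le> N h" for h
    unfolding N_def by (intro infsum_nonneg) simp
  have N_B: "N B = N g"
    using e(3)[OF g] by (simp add: hardy2_norm_eq N_def B_def)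
  have A1: "taylor_coeffs (\<lambda>(z, w). eval2 p z w * f (z, w) - 1) x = taylor_coeffs A x + (if x = (0, 0) then - 1 else 0)" for x
    using taylor_coeffs_add[OF A hardy2_const[of "- 1"]]
    by (simp add: A_def case_prod_unfold taylor_coeffs_const)
  \<comment> \<open>Orthogonality of \<open>A - 1\<close> to \<open>h\<close>; as 1 has only a
    constant coefficient, its inner product with \<open>h\<close> is the real part of
    \<open>h (0, 0)\<close>.\<close>
  have orth: "(\<Sum>\<^sub>\<infinity>x. taylor_coeffs A x \<bullet> taylor_coeffs h x) = 1 \<bullet> h (0, 0)"
    if q: "q \<in> poly_space n" and h_def: "h = (\<lambda>(z, w). eval2 q z w * f (z, w))" for q h
  proof -
    have h: "h \<in> hardy2"
      using hardy2_eval2_mult[OF f(1), of q] by (simp add: case_prod_unfold h_def)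
    have "0 = (\<Sum>\<^sub>\<infinity>x. (taylor_coeffs A x + (if x = (0, 0) then - 1 else 0)) \<bullet> taylor_coeffs h x)"
      using is_opa_orthogonal[OF f(1) p q] unfolding A1 h_def by simp
    also have "\<dots> = (\<Sum>\<^sub>\<infinity>x. taylor_coeffs A x \<bullet> taylor_coeffs h x + taylor_coeffs (\<lambda>x. - 1) x \<bullet> taylor_coeffs h x)"
      by (simp add: inner_add_left taylor_coeffs_const)
    also have "\<dots> = (\<Sum>\<^sub>\<infinity>x. taylor_coeffs A x \<bullet> taylor_coeffs h x) + (\<Sum>\<^sub>\<infinity>x. taylor_coeffs (\<lambda>x. - 1) x \<bullet> taylor_coeffs h x)"
      by (intro infsum_add summable_on_inner hardy2_summable A h hardy2_const)
    also have "(\<Sum>\<^sub>\<infinity>x. taylor_coeffs (\<lambda>x. - 1) x \<bullet> taylor_coeffs h x) = - (1 \<bullet> h (0, 0))"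
      by (subst infsum_single[where c = "(0, 0)"]) (auto simp: taylor_coeffs_const taylor_coeffs_0)
    finally show ?thesis by simp
  qed
  have "N A \<noteq> 0"
  proof
    assume "N A = 0"
    then have zero: "taylor_coeffs A x = 0" for x
      using nonneg_infsum_le_0D[OF _ hardy2_summable[OF A], of x] by (simp add: N_def)
    \<comment> \<open>The factor \<open>cnj (f (0, 0))\<close> turns the value at the origin into
      the positive number \<open>(norm (f (0, 0)))\<^sup>2\<close>; the real part of
      \<open>f (0, 0)\<close> itself could be 0.\<close>
    define h where "h = (\<lambda>(z, w). eval2 [:[:cnj (f (0, 0)):]:] z w * f (z, w))"
    have "1 \<bullet> h (0, 0) = 0"
      using orth[OF poly_space_const h_def] zero by simp
    moreover have "1 \<bullet> h (0, 0) = (norm (f (0, 0)))\<^sup>2"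
      unfolding h_def by (simp add: inner_complex_def cmod_power2 flip: power2_eq_square)
    ultimately show False using f(2) by simp
  qed
  have "(\<Sum>\<^sub>\<infinity>x. taylor_coeffs A x \<bullet> taylor_coeffs B x) = 0"
  proof -
    have "B = (\<lambda>(z, w). eval2 r z w * f (z, w))"
      by (auto simp: B_def g_def eval)
    from orth[OF r this] show ?thesis by (simp add: B_def e(1))
  qed
  \<comment> \<open>Pythagoras for \<open>A - B\<close>, which equals
    \<open>- \<alpha> g\<close>.\<close>
  then have "(\<Sum>\<^sub>\<infinity>x. (norm (taylor_coeffs A x + (- 1) *\<^sub>R taylor_coeffs B x))\<^sup>2) = N A + N B"
    using infsum_norm_add_scaleR[OF hardy2_summable[OF A] hardy2_summable[OF B], of "- 1"]
    by (simp add: N_def)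
  moreover have "taylor_coeffs A x + (- 1) *\<^sub>R taylor_coeffs B x = - \<alpha> * taylor_coeffs g x" for x
  proof -
    have "A = (\<lambda>x. B x + (- \<alpha>) * g x)"
      by (auto simp: A_def B_def g_def eval algebra_simps)
    then have "taylor_coeffs A = (\<lambda>x. taylor_coeffs B x + (- \<alpha>) * taylor_coeffs g x)"
      by (simp only: taylor_coeffs_add[OF B hardy2_cmult[OF g]] taylor_coeffs_cmult[OF g])
    then show ?thesis by simp
  qed
  ultimately have "(cmod \<alpha>)\<^sup>2 * N g = N A + N g"
    by (simp add: norm_mult power_mult_distrib infsum_cmult_right' N_B[unfolded N_def] N_def)
  \<comment> \<open>Together with the previous identity this would give \<open>N A \<le> 0\<close>,
    although \<open>N A\<close> is positive.\<close>
  moreover have "(cmod \<alpha>)\<^sup>2 * N g \<le> N g" if "cmod \<alpha> \<le> 1"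
    using that N_nonneg[of g] by (simp add: mult_left_le_one_le power_le_one)
  ultimately show ?thesis
    using \<open>N A \<noteq> 0\<close> N_nonneg[of A] by (cases "cmod \<alpha> \<le> 1") auto
qed

theorem proposition3p1:
  fixes f :: "complex \<times> complex \<Rightarrow> complex" and n :: nat and p :: "complex poly poly"
  assumes "f \<in> hardy2" and "f (0, 0) \<noteq> 0" and "is_opa n f p"
  shows "(\<forall>\<alpha> p'. (\<forall>z w. eval2 p z w = (z - \<alpha>) * eval2 p' z w) \<longrightarrow> cmod \<alpha> > 1) \<and>
         (\<forall>\<beta> q'. (\<forall>z w. eval2 p z w = (w - \<beta>) * eval2 q' z w) \<longrightarrow> cmod \<beta> > 1)"
proof (intro conjI allI impI)
  have p: "p \<in> poly_space n" using assms(3) by (simp add: is_opa_def)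
  {
    fix \<alpha> p' assume eval: "\<forall>z w. eval2 p z w = (z - \<alpha>) * eval2 p' z w"
    then have "p = [:[:- \<alpha>, 1:]:] * p'"
      by (intro eval2_inject) (simp add: algebra_simps)
    \<comment> \<open>The polynomial \<open>z p'\<close> is the direction in which the minimality of
      \<open>p\<close> is exploited.\<close>
    with p have "[:[:0, 1:]:] * p' \<in> poly_space n"
      using poly_space_times_fst by blast
    with eval show "cmod \<alpha> > 1"
      by (intro is_opa_linear_factor[OF assms, where e = fst])
        (auto simp: hardy2_times_fst)
  next
    fix \<beta> q' assume eval: "\<forall>z w. eval2 p z w = (w - \<beta>) * eval2 q' z w"
    then have "p = [:[:- \<beta>:], 1:] * q'"
      by (intro eval2_inject) (simp add: algebra_simps)
    with p have "[:0, 1:] * q' \<in> poly_space n"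
      using poly_space_times_snd by blast
    with eval show "cmod \<beta> > 1"
      by (intro is_opa_linear_factor[OF assms, where e = snd])
        (auto simp: hardy2_times_snd)
  }
qed

end
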